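(* For any two stationary randomized policies $\pi_1$ and $\pi_2$, the difference of their long-run average costs satisfies $$\eta_{\pi_2}-\eta_{\pi_1}\le \mathbb E_{x\sim d_{\pi_1},\,a\sim\pi_2(\cdot|x)}\left[A_{\pi_1}(x,a)\right]+2\,\epsilon_{\pi_2}\,\tau_1\!\left[D_{\pi_2}\right]\,\mathbb E_{x\sim d_{\pi_1}}\left[\mathrm{TV}\big(\pi_2(\cdot|x)\,\|\,\pi_1(\cdot|x)\big)\right],$$ where $D_{\pi_2}$ is the group inverse of $I-P_{\pi_2}$ and $\epsilon_{\pi_2}=\max_{x\in\mathcal X}\big|\mathbb E_{a\sim\pi_2(\cdot|x)}[A_{\pi_1}(x,a)]\big|$.
   Context: Setting: a Markov decision process with finite state space $\mathcal X$, finite action space $\mathcal A$, transition probabilities $P(y|x,a)$, cost function $g:\mathcal X\times\mathcal A\to\mathbb R$, initial state distribution $\mu$. For a stationary randomized policy $\pi$, $P_\pi(x,y)=\sum_a\pi(a|x)P(y|x,a)$; the MDP is unichain: for every stationary policy, $P_\pi$ has a single recurrent class, and $d_\pi$ is its unique stationary distribution. Long-run average cost: $\eta_\pi=\lim_{N\to\infty}\frac1N\mathbb E_\pi[\sum_{t=0}^{N-1}g(x^{(t)},a^{(t)})\mid x^{(0)}\sim\mu]=\mathbb E_{x\sim d_\pi,a\sim\pi(\cdot|x)}[g(x,a)]$ (independent of $\mu$). Relative value function: $V_\pi(x)=\lim_{N\to\infty}\mathbb E_\pi[\sum_{t=0}^{N-1}(g(x^{(t)},a^{(t)})-\eta_\pi)\mid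 x^{(0)}=x]$, the limit being assumed to exist. $Q_\pi(x,a)=g(x,a)-\eta_\pi+\mathbb E_{y\sim P(\cdot|x,a)}[V_\pi(y)]$, and $A_\pi=Q_\pi-V_\pi$. The group inverse $D$ of a matrix $A$ is the unique matrix with $ADA=A$, $DAD=D$, $DA=AD$. The one-norm ergodicity coefficient is $\tau_1[A]=\max\{\|A^Tx\|_1:\|x\|_1=1,\ x^Te=0\}$, $e$ the all-ones vector. $\mathrm{TV}(\pi_2(\cdot|x)\|\pi_1(\cdot|x))=\frac12\sum_a|\pi_2(a|x)-\pi_1(a|x)|$. *)

theory Defs
  imports "HOL-Probability.Probability"
begin

type_synonym ('s, 'a) transition = "'s \<Rightarrow> 'a \<Rightarrow> 's pmf"
type_synonym ('s, 'a) policy = "'s \<Rightarrow> 'a pmf"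

primrec trajectory ::
    "('s, 'a) transition \<Rightarrow> ('s, 'a) policy \<Rightarrow> nat \<Rightarrow> 's \<Rightarrow> ('s \<times> 'a) list pmf" where
  "trajectory P \<pi> 0 x = return_pmf []"
| "trajectory P \<pi> (Suc N) x =
     bind_pmf (\<pi> x) (\<lambda>a. bind_pmf (P x a) (\<lambda>y. map_pmf (\<lambda>\<omega>. (x, a) # \<omega>) (trajectory P \<pi> N y)))"

definition expected_total_cost ::
    "('s, 'a) transition \<Rightarrow> ('s \<Rightarrow> 'a \<Rightarrow> real) \<Rightarrow> ('s, 'a) policy \<Rightarrow> 's pmf \<Rightarrow> nat \<Rightarrow> real" where
  "expected_total_cost P g \<pi> \<mu> N =
     measure_pmf.expectation (bind_pmf \<mu> (trajectory P \<pi> N)) (\<lambda>\<omega>. \<Sum>(x, a)\<leftarrow>\<omega>. g x a)"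

definition average_cost ::
    "('s, 'a) transition \<Rightarrow> ('s \<Rightarrow> 'a \<Rightarrow> real) \<Rightarrow> 's pmf \<Rightarrow> ('s, 'a) policy \<Rightarrow> real" where
  "average_cost P g \<mu> \<pi> = lim (\<lambda>N. expected_total_cost P g \<pi> \<mu> N / real N)"

definition relative_cost ::
    "('s, 'a) transition \<Rightarrow> ('s \<Rightarrow> 'a \<Rightarrow> real) \<Rightarrow> 's pmf \<Rightarrow> ('s, 'a) policy \<Rightarrow> 's \<Rightarrow> nat \<Rightarrow> real" where
  "relative_cost P g \<mu> \<pi> x N =
     expected_total_cost P (\<lambda>x a. g x a - average_cost P g \<mu> \<pi>) \<pi> (return_pmf x) N"

definition relative_value ::
    "('s, 'a) transition \<Rightarrow> ('s \<Rightarrow> 'a \<Rightarrow> real) \<Rightarrow> 's pmf \<Rightarrow> ('s, 'a) policy \<Rightarrow> 's \<Rightarrow> real" where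
  "relative_value P g \<mu> \<pi> x = lim (relative_cost P g \<mu> \<pi> x)"

definition Q_value ::
    "('s, 'a) transition \<Rightarrow> ('s \<Rightarrow> 'a \<Rightarrow> real) \<Rightarrow> 's pmf \<Rightarrow> ('s, 'a) policy \<Rightarrow> 's \<Rightarrow> 'a \<Rightarrow> real" where
  "Q_value P g \<mu> \<pi> x a = g x a - average_cost P g \<mu> \<pi>
     + measure_pmf.expectation (P x a) (relative_value P g \<mu> \<pi>)"

definition advantage ::
    "('s, 'a) transition \<Rightarrow> ('s \<Rightarrow> 'a \<Rightarrow> real) \<Rightarrow> 's pmf \<Rightarrow> ('s, 'a) policy \<Rightarrow> 's \<Rightarrow> 'a \<Rightarrow> real" where
  "advantage P g \<mu> \<pi> x a = Q_value P g \<mu> \<pi> x a - relative_value P g \<mu> \<pi> x"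

definition policy_matrix ::
    "('s::finite, 'a::finite) transition \<Rightarrow> ('s, 'a) policy \<Rightarrow> real ^ 's ^ 's" where
  "policy_matrix P \<pi> = (\<chi> x y. \<Sum>a\<in>UNIV. pmf (\<pi> x) a * pmf (P x a) y)"

definition accessible :: "real ^ 'n ^ 'n \<Rightarrow> ('n::finite) rel" where
  "accessible M = {(x, y). M $ x $ y > 0}\<^sup>*"

text \<open>For a finite chain, a state is recurrent iff it is accessible from every state that is
  accessible from it; a recurrent class is the communicating class of a recurrent state.\<close>

definition recurrent_state :: "real ^ 'n ^ 'n \<Rightarrow> 'n::finite \<Rightarrow> bool" where
  "recurrent_state M x \<longleftrightarrow> (\<forall>y. (x, y) \<in> accessible M \<longrightarrow> (y, x) \<in> accessible M)"

definition recurrent_class :: "real ^ 'n ^ 'n \<Rightarrow> ('n::finite) set \<Rightarrow> bool" where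
  "recurrent_class M C \<longleftrightarrow>
     (\<exists>x. recurrent_state M x \<and> C = {y. (x, y) \<in> accessible M \<and> (y, x) \<in> accessible M})"

definition unichain :: "('s::finite, 'a::finite) transition \<Rightarrow> bool" where
  "unichain P \<longleftrightarrow> (\<forall>\<pi>. \<exists>!C. recurrent_class (policy_matrix P \<pi>) C)"

definition stationary_dist ::
    "('s::finite, 'a::finite) transition \<Rightarrow> ('s, 'a) policy \<Rightarrow> 's pmf" where
  "stationary_dist P \<pi> = (THE d. (\<chi> x. pmf d x) v* policy_matrix P \<pi> = (\<chi> x. pmf d x))"

definition is_group_inverse :: "real ^ 'n ^ 'n \<Rightarrow> real ^ 'n ^ ('n::finite) \<Rightarrow> bool" where
  "is_group_inverse A D \<longleftrightarrow> A ** D ** A = A \<and> D ** A ** D = D \<and> D ** A = A ** D"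

definition group_inverse :: "real ^ 'n ^ 'n \<Rightarrow> real ^ 'n ^ ('n::finite)" where
  "group_inverse A = (THE D. is_group_inverse A D)"

lemma is_group_inverse_unique:
  assumes "is_group_inverse A D" and "is_group_inverse A E"
  shows "D = E"
proof -
  have D: "A ** D ** A = A" "D ** A ** D = D" "D ** A = A ** D"
    and E: "A ** E ** A = A" "E ** A ** E = E" "E ** A = A ** E"
    using assms by (auto simp: is_group_inverse_def)
  have "A ** D = (A ** E) ** (A ** D)"
    using E(1) by (metis matrix_mul_assoc)
  also have "\<dots> = E ** (A ** D ** A)"
    using E(3) D(3) by (metis matrix_mul_assoc)
  also have "\<dots> = A ** E"
    using D(1) E(3) by simp
  finally have AD: "A ** D = A ** E" .
  have "D = D ** (A ** D)" using D(2) by (simp add: matrix_mul_assoc)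
  also have "\<dots> = D ** A ** E" using AD by (simp add: matrix_mul_assoc)
  also have "\<dots> = E ** A ** E" using AD D(3) E(3) by simp
  finally show ?thesis using E(2) by simp
qed

definition norm1 :: "real ^ 'n \<Rightarrow> real" where
  "norm1 x = (\<Sum>i\<in>UNIV. \<bar>x $ i\<bar>)"

text \<open>In dimension one no vector satisfies both constraints, so the maximum is over the empty
  set; the coefficient is then taken to be 0. In higher dimensions the supremum is attained.\<close>

definition ergodicity_coeff :: "real ^ 'n ^ ('n::finite) \<Rightarrow> real" where
  "ergodicity_coeff A = (if CARD('n) = 1 then 0
     else Sup {norm1 (transpose A *v x) | x. norm1 x = 1 \<and> (\<Sum>i\<in>UNIV. x $ i) = 0})"

lemma ergodicity_coeff_attained:
  fixes A :: "real ^ 'n ^ ('n::finite)"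
  assumes "CARD('n) \<noteq> 1"
  obtains x :: "real ^ 'n"
  where "norm1 x = 1" and "(\<Sum>i\<in>UNIV. x $ i) = 0"
    and "ergodicity_coeff A = norm1 (transpose A *v x)"
    and "\<And>z. norm1 z = 1 \<Longrightarrow> (\<Sum>i\<in>UNIV. z $ i) = 0 \<Longrightarrow>
           norm1 (transpose A *v z) \<le> norm1 (transpose A *v x)"
proof -
  let ?S = "{x :: real ^ 'n. norm1 x = 1 \<and> (\<Sum>i\<in>UNIV. x $ i) = 0}"
  let ?f = "\<lambda>x. norm1 (transpose A *v x)"
  obtain i j :: 'n where ij: "i \<noteq> j"
    using assms by (metis (full_types) UNIV_I card_1_singleton_iff is_singletonI' is_singleton_altdef
        UNIV_not_empty)
  define u :: "real ^ 'n" where "u = (\<chi> k. if k = i then 1/2 else if k = j then -1/2 else 0)"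
  have ne: "?S \<noteq> {}"
  proof -
    have "(\<Sum>k\<in>UNIV. \<bar>u $ k\<bar>) = (\<Sum>k\<in>UNIV. (if k = i then 1/2 else 0) + (if k = j then 1/2 else 0))"
      using ij by (intro sum.cong) (auto simp: u_def)
    moreover have "(\<Sum>k\<in>UNIV. u $ k) = (\<Sum>k\<in>UNIV. (if k = i then 1/2 else 0) + (if k = j then -1/2 else 0))"
      using ij by (intro sum.cong) (auto simp: u_def)
    ultimately have "u \<in> ?S" by (simp add: norm1_def sum.distrib)
    then show ?thesis by blast
  qed
  have "closed ?S"
    unfolding norm1_def by (intro closed_Collect_conj closed_Collect_eq continuous_intros)
  moreover have "bounded ?S"
    unfolding bounded_iff
    by (rule exI[of _ 1], clarify) (metis norm_le_l1_cart norm1_def)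
  ultimately have "compact ?S" by (simp add: compact_eq_bounded_closed)
  moreover have "continuous_on ?S ?f"
    unfolding norm1_def matrix_vector_mult_def by (auto intro!: continuous_intros)
  ultimately obtain x where x: "x \<in> ?S" "\<And>z. z \<in> ?S \<Longrightarrow> ?f z \<le> ?f x"
    using continuous_attains_sup[OF _ ne] by blast
  have "Sup {?f x | x. norm1 x = 1 \<and> (\<Sum>i\<in>UNIV. x $ i) = 0} = ?f x"
    using x by (intro cSup_eq_maximum) auto
  then show thesis
    using x assms by (intro that[of x]) (auto simp: ergodicity_coeff_def)
qed

definition TV :: "'a::finite pmf \<Rightarrow> 'a pmf \<Rightarrow> real" where
  "TV p q = 1 / 2 * (\<Sum>a\<in>UNIV. \<bar>pmf p a - pmf q a\<bar>)"

definition max_expected_advantage ::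
    "('s::finite, 'a) transition \<Rightarrow> ('s \<Rightarrow> 'a \<Rightarrow> real) \<Rightarrow> 's pmf \<Rightarrow> ('s, 'a) policy \<Rightarrow> ('s, 'a) policy \<Rightarrow> real"
  where
  "max_expected_advantage P g \<mu> \<pi>1 \<pi>2 =
     (MAX x. \<bar>measure_pmf.expectation (\<pi>2 x) (advantage P g \<mu> \<pi>1 x)\<bar>)"

end

theory Submission
  imports Defs
begin

text \<open>
  The kernel of \<open>I - M\<close> consists of constant vectors: the sets where a harmonic vector is maximal and
  minimal are both closed, so each contains the single recurrent class. Hence \<open>I - M + e d\<^sup>T\<close> is
  invertible, and subtracting \<open>e d\<^sup>T\<close> from its inverse gives the group inverse \<open>D\<close>, with
  \<open>(I - M) D = I - e d\<^sup>T\<close>. Applying this to \<open>d\<^sub>1\<^sup>T (P\<^sub>2 - P\<^sub>1) = d\<^sub>1\<^sup>T (P\<^sub>2 - I)\<close> yields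
  \<open>d\<^sub>2 - d\<^sub>1 = D\<^sub>2\<^sup>T (P\<^sub>2 - P\<^sub>1)\<^sup>T d\<^sub>1\<close>, whose 1-norm is controlled by \<open>\<tau>\<^sub>1[D\<^sub>2]\<close> and the total variation.
  Since \<open>d\<^sub>2\<^sup>T (P\<^sub>2 V - V) = 0\<close> for every \<open>V\<close>, the cost difference is the \<open>d\<^sub>2\<close>-average of the expected
  advantage; the claim follows on replacing \<open>d\<^sub>2\<close> by \<open>d\<^sub>1 + (d\<^sub>2 - d\<^sub>1)\<close>.
\<close>

section \<open>Recurrent states and harmonic vectors of a finite chain\<close>

lemma recurrent_state_accessible:
  fixes M :: "real ^ 'n ^ ('n::finite)"
  obtains y where "(x, y) \<in> accessible M" "recurrent_state M y"
proof -
  let ?R = "\<lambda>y. {z. (y, z) \<in> accessible M}"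
  have trans: "(a, c) \<in> accessible M"
    if "(a, b) \<in> accessible M" "(b, c) \<in> accessible M" for a b c
    using that unfolding accessible_def by (rule rtrancl_trans)
  have refl: "(a, a) \<in> accessible M" for a
    unfolding accessible_def by simp
  \<comment> \<open>Among the states reachable from \<open>x\<close>, \<open>y\<close> has the
    smallest reachable set. Moving on from \<open>y\<close> can only shrink that set, so minimality
    forces equality and every state reachable from \<open>y\<close> leads back to it.\<close>
  obtain y where y: "(x, y) \<in> accessible M"
    and min: "\<And>z. (x, z) \<in> accessible M \<Longrightarrow> card (?R y) \<le> card (?R z)"
    using ex_has_least_nat[of "\<lambda>y. (x, y) \<in> accessible M" x "\<lambda>y. card (?R y)"] refl by blast
  have "(z, y) \<in> accessible M" if z: "(y, z) \<in> accessible M" for z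
  proof -
    have "?R z \<subseteq> ?R y"
      using trans z by blast
    moreover have "card (?R y) \<le> card (?R z)"
      using min trans y z by blast
    ultimately have "?R z = ?R y"
      by (intro card_seteq) auto
    then show ?thesis using refl by blast
  qed
  then have "recurrent_state M y"
    by (simp add: recurrent_state_def)
  then show thesis using that y by blast
qed

locale unichain_matrix =
  fixes M :: "real ^ 'n ^ ('n::finite)"
  assumes nonneg: "0 \<le> M $ x $ y"
    and row_sum: "(\<Sum>y\<in>UNIV. M $ x $ y) = 1"
    and unique_class: "\<exists>!C. recurrent_class M C"
begin

text \<open>The point at which \<open>unique_class\<close> enters: the communicating classes of both
  states are recurrent classes, hence equal.\<close>

lemma recurrent_states_accessible:
  assumes "recurrent_state M x" "recurrent_state M y"
  shows "(x, y) \<in> accessible M"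
proof -
  let ?C = "\<lambda>x. {y. (x, y) \<in> accessible M \<and> (y, x) \<in> accessible M}"
  have "recurrent_class M (?C x)" "recurrent_class M (?C y)"
    using assms unfolding recurrent_class_def by blast+
  then have "?C x = ?C y"
    using unique_class by blast
  moreover have "y \<in> ?C y"
    by (simp add: accessible_def)
  ultimately show ?thesis by blast
qed

text \<open>A harmonic value is a weighted average over successors. When it equals the upper bound
  \<open>m\<close>, the nonnegative gaps \<open>m - v $ w\<close> average to zero, so every
  successor of positive weight attains \<open>m\<close> as well; induction carries this along
  paths.\<close>

lemma maximum_principle:
  assumes harm: "M *v v = v" and le: "\<And>z. v $ z \<le> m"
    and acc: "(x, y) \<in> accessible M" and x: "v $ x = m"
  shows "v $ y = m"
  using acc unfolding accessible_def
proof (induction rule: rtrancl_induct)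
  case base
  show ?case by (fact x)
next
  case (step y z)
  have "(\<Sum>w\<in>UNIV. M $ y $ w * v $ w) = m"
    using arg_cong[OF harm, of "\<lambda>u. u $ y"] step.IH by (simp add: matrix_vector_mult_def)
  then have "(\<Sum>w\<in>UNIV. M $ y $ w * (m - v $ w)) = 0"
    using row_sum[of y]
    by (simp add: right_diff_distrib sum_subtractf sum_distrib_right[symmetric])
  moreover have "0 \<le> M $ y $ w * (m - v $ w)" for w
    using nonneg le by simp
  ultimately have "M $ y $ z * (m - v $ z) = 0"
    using sum_nonneg_eq_0_iff[of UNIV "\<lambda>w. M $ y $ w * (m - v $ w)"] by simp
  then show ?case using step.hyps by auto
qed

lemma harmonic_constant:
  assumes harm: "M *v v = v"
  shows "v $ x = v $ y"
proof -
  have "v $ x \<le> v $ y" for x y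
  proof -
    obtain a where a: "\<And>z. v $ z \<le> v $ a"
      using Max_in[of "range (($) v)"] Max_ge[of "range (($) v)"] by fastforce
    obtain b where b: "\<And>z. v $ b \<le> v $ z"
      using Min_in[of "range (($) v)"] Min_le[of "range (($) v)"] by fastforce
    obtain a' where a': "(a, a') \<in> accessible M" "recurrent_state M a'"
      by (rule recurrent_state_accessible)
    obtain b' where b': "(b, b') \<in> accessible M" "recurrent_state M b'"
      by (rule recurrent_state_accessible)
    \<comment> \<open>The recurrent state \<open>b'\<close> serves both extremes: it is reached from
      the minimiser \<open>b\<close> directly and from the maximiser \<open>a\<close> through
      \<open>a'\<close>.\<close>
    have "(a, b') \<in> accessible M"
      using a' recurrent_states_accessible[OF a'(2) b'(2)]
      unfolding accessible_def by simp
    then have "v $ b' = v $ a"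
      using maximum_principle[OF harm a] by simp
    \<comment> \<open>The minimum of \<open>v\<close> is handled as the maximum of the harmonic
      vector \<open>- v\<close>.\<close>
    moreover have "M *v (- v) = - v"
      using harm by (metis matrix_vector_mult_diff_distrib matrix_vector_mult_0_right diff_0)
    then have "(- v) $ b' = - v $ b"
      using maximum_principle[of "- v" "- v $ b" b b'] b b'(1) by simp
    ultimately show ?thesis
      using a[of x] b[of y] by simp
  qed
  then show ?thesis by (intro antisym)
qed

section \<open>Stationary distributions and the group inverse\<close>

lemma mult_const: "M *v vec c = vec c"
  using row_sum by (simp add: vec_eq_iff matrix_vector_mult_def flip: sum_distrib_right)

lemma sum_vector_mult: "(\<Sum>y\<in>UNIV. (u v* M) $ y) = (\<Sum>x\<in>UNIV. u $ x)"
proof -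
  have "(\<Sum>y\<in>UNIV. (u v* M) $ y) = (\<Sum>x\<in>UNIV. \<Sum>y\<in>UNIV. M $ x $ y * u $ x)"
    unfolding vector_matrix_mult_def by (simp add: mult.commute, rule sum.swap)
  then show ?thesis
    using row_sum by (simp flip: sum_distrib_right)
qed

text \<open>Constants lie in the kernel of \<open>mat 1 - M\<close>, so its transpose is singular
  too and has a nonzero kernel vector \<open>u\<close>. The entrywise absolute value of
  \<open>u\<close> is again invariant, and normalising it gives a distribution.\<close>

lemma stationary_pmf_exists:
  obtains d where "(\<chi> x. pmf d x) v* M = (\<chi> x. pmf d x)"
proof -
  have "\<not> invertible (mat 1 - M)"
  proof
    assume "invertible (mat 1 - M)"
    then obtain B where "B ** (mat 1 - M) = mat 1"
      unfolding invertible_def by blast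
    then have "vec 1 = B *v ((mat 1 - M) *v vec 1)"
      by (simp add: matrix_vector_mul_assoc)
    also have "\<dots> = 0"
      using mult_const[of 1] by (simp add: matrix_vector_mult_diff_rdistrib)
    finally show False by (simp add: vec_eq_iff)
  qed
  then have "\<not> invertible (transpose (mat 1 - M))"
    using invertible_det_nz det_transpose by metis
  then obtain u where u: "transpose (mat 1 - M) *v u = 0" "u \<noteq> 0"
    using invertible_left_inverse matrix_left_invertible_ker by metis
  then have uM: "u v* M = u"
    by (simp add: vector_matrix_mult_diff_rdistrib)
  define w where "w = (\<chi> x. \<bar>u $ x\<bar>)"
  have le: "w $ y \<le> (w v* M) $ y" for y
  proof -
    have "\<bar>u $ y\<bar> = \<bar>(u v* M) $ y\<bar>"
      using uM by simp
    also have "\<dots> \<le> (\<Sum>x\<in>UNIV. \<bar>M $ x $ y * u $ x\<bar>)"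
      unfolding vector_matrix_mult_def by (simp add: mult.commute)
    also have "\<dots> = (w v* M) $ y"
      unfolding vector_matrix_mult_def w_def using nonneg by (simp add: abs_mult mult.commute)
    finally show ?thesis by (simp add: w_def)
  qed
  \<comment> \<open>Multiplication by \<open>M\<close> preserves total mass, so the entrywise
    inequality \<open>le\<close> leaves no slack.\<close>
  have "(\<Sum>y\<in>UNIV. (w v* M) $ y - w $ y) = 0"
    using sum_vector_mult by (simp add: sum_subtractf)
  then have "(w v* M) $ y - w $ y = 0" for y
    using le sum_nonneg_eq_0_iff[of UNIV "\<lambda>y. (w v* M) $ y - w $ y"] by simp
  then have wM: "w v* M = w"
    by (simp add: vec_eq_iff)
  define s where "s = (\<Sum>x\<in>UNIV. w $ x)"
  have "s \<noteq> 0"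
    using u(2) by (auto simp: s_def w_def sum_nonneg_eq_0_iff vec_eq_iff)
  moreover have "0 \<le> s"
    by (auto simp: s_def w_def intro: sum_nonneg)
  ultimately have s: "0 < s" by simp
  have "pmf (embed_pmf (\<lambda>x. w $ x / s)) x = w $ x / s" for x
  proof (rule pmf_embed_pmf)
    show "0 \<le> w $ x / s" for x
      using s by (simp add: w_def)
    then have "(\<integral>\<^sup>+ x. ennreal (w $ x / s) \<partial>count_space UNIV) = ennreal (\<Sum>x\<in>UNIV. w $ x / s)"
      by (simp add: nn_integral_count_space_finite sum_ennreal)
    then show "(\<integral>\<^sup>+ x. ennreal (w $ x / s) \<partial>count_space UNIV) = 1"
      using s by (simp add: s_def flip: sum_divide_distrib)
  qed
  then have "(\<chi> x. pmf (embed_pmf (\<lambda>x. w $ x / s)) x) = (1 / s) *\<^sub>R w"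
    by (simp add: vec_eq_iff)
  then show thesis
    using that[of "embed_pmf (\<lambda>x. w $ x / s)"] wM
    by (metis scaleR_vector_matrix_assoc vector_scaleR_matrix_ac)
qed

text \<open>Both claims rest on the invertible matrix \<open>B = A + J\<close>, where every row of
  \<open>J\<close> is \<open>d\<close>. Pairing \<open>B *v v\<close> with any invariant vector of
  mass one returns \<open>d \<bullet> v\<close>; since \<open>B\<close> is onto, this determines the
  invariant vector.\<close>

lemma group_inverse_stationary:
  assumes dM: "d v* M = d" and d1: "(\<Sum>x\<in>UNIV. d $ x) = 1"
  shows "\<And>v. (mat 1 - M) *v (group_inverse (mat 1 - M) *v v) = v - vec (d \<bullet> v)"
    and "\<And>d'. d' v* M = d' \<Longrightarrow> (\<Sum>x\<in>UNIV. d' $ x) = 1 \<Longrightarrow> d' = d"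
proof -
  define J where "J = (\<chi> x::'n. d)"
  define A where "A = mat 1 - M"
  define B where "B = A + J"
  have Jv: "J *v v = vec (d \<bullet> v)" for v
    by (simp add: J_def vec_eq_iff matrix_vector_mult_def inner_vec_def)
  have Av: "A *v v = v - M *v v" for v
    by (simp add: A_def matrix_vector_mult_diff_rdistrib)
  have A_const: "A *v vec c = 0" for c
    by (simp add: Av mult_const)
  have Bv: "B *v v = A *v v + vec (d \<bullet> v)" for v
    by (simp add: B_def Jv matrix_vector_mult_add_rdistrib)
  have d_vec: "u \<bullet> vec c = c" if "(\<Sum>x\<in>UNIV. u $ x) = 1" for u and c :: real
    using that by (simp add: inner_vec_def flip: sum_distrib_right)
  have dA: "u \<bullet> (A *v v) = 0" if "u v* M = u" for u v
    using that by (simp add: Av inner_diff_right flip: dot_lmul_matrix)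
  have dB: "u \<bullet> (B *v v) = d \<bullet> v" if "u v* M = u" "(\<Sum>x\<in>UNIV. u $ x) = 1" for u v
    using that by (simp add: Bv inner_add_right dA d_vec)
  \<comment> \<open>Pairing with \<open>d\<close> gives \<open>d \<bullet> v = 0\<close>. Then
    \<open>v\<close> is harmonic, hence constant, and a constant of zero mean vanishes.\<close>
  have "v = 0" if "B *v v = 0" for v
  proof -
    have dv: "d \<bullet> v = 0"
      using that dB[OF dM d1, of v] by simp
    then have "M *v v = v"
      using that by (simp add: Bv Av vec_eq_iff)
    then have "v = vec (v $ undefined)"
      using harmonic_constant by (metis vec_eq_iff vec_component)
    then show "v = 0"
      using dv d_vec[OF d1] by (metis vec_0)
  qed
  then obtain C where C: "C ** B = mat 1" "B ** C = mat 1"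
    using matrix_left_invertible_ker matrix_left_right_inverse by metis
  have CB: "C *v (B *v v) = v" and BC: "B *v (C *v v) = v" for v
    using C by (simp_all add: matrix_vector_mul_assoc)
  show "d' = d" if "d' v* M = d'" "(\<Sum>x\<in>UNIV. d' $ x) = 1" for d'
  proof -
    have "d' \<bullet> v = d \<bullet> v" for v
      using dB[OF that, of "C *v v"] dB[OF dM d1, of "C *v v"] by (simp add: BC)
    then show ?thesis by (metis vector_eq_rdot)
  qed
  have dC: "d \<bullet> (C *v v) = d \<bullet> v" for v
    using dB[OF dM d1, of "C *v v"] by (simp add: BC)
  have "B *v vec c = vec c" for c
    by (simp add: Bv A_const d_vec[OF d1])
  then have C_const: "C *v vec c = vec c" for c
    using CB[of "vec c"] by simp
  \<comment> \<open>\<open>J\<close> projects onto the constants, which \<open>C\<close> fixes.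
    Subtracting it makes \<open>D\<close> vanish on the kernel of \<open>A\<close>, as a group
    inverse must.\<close>
  define D where "D = C - J"
  have Dv: "D *v v = C *v v - vec (d \<bullet> v)" for v
    by (simp add: D_def Jv matrix_vector_mult_diff_rdistrib)
  have DA: "D *v (A *v v) = v - vec (d \<bullet> v)" for v
  proof -
    have "D *v (A *v v) = C *v (B *v v - vec (d \<bullet> v))"
      by (simp add: Dv dA[OF dM] Bv)
    then show ?thesis
      by (simp add: matrix_vector_mult_diff_distrib CB C_const)
  qed
  have AD: "A *v (D *v v) = v - vec (d \<bullet> v)" for v
  proof -
    have "A *v (D *v v) = A *v (C *v v)"
      by (simp add: Dv matrix_vector_mult_diff_distrib A_const)
    also have "\<dots> = B *v (C *v v) - vec (d \<bullet> v)"
      by (simp add: Bv dC)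
    finally show ?thesis by (simp add: BC)
  qed
  have D_const: "D *v vec c = 0" for c
    by (simp add: Dv C_const d_vec[OF d1])
  \<comment> \<open>Both products of \<open>A\<close> and \<open>D\<close> equal the identity minus
    \<open>J\<close>, and both matrices annihilate constants; the three identities follow.\<close>
  have "is_group_inverse A D"
    unfolding is_group_inverse_def matrix_eq
    by (simp add: AD DA A_const D_const matrix_vector_mult_diff_distrib flip: matrix_vector_mul_assoc)
  then have "group_inverse A = D"
    unfolding group_inverse_def using is_group_inverse_unique by blast
  then show "(mat 1 - M) *v (group_inverse (mat 1 - M) *v v) = v - vec (d \<bullet> v)" for v
    using AD by (simp add: A_def)
qed

section \<open>Long-run averages of accumulated costs\<close>

lemma mult_bound:
  assumes "\<And>x. \<bar>v $ x\<bar> \<le> b"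
  shows "\<bar>(M *v v) $ x\<bar> \<le> b"
proof -
  have "\<bar>(M *v v) $ x\<bar> \<le> (\<Sum>y\<in>UNIV. \<bar>M $ x $ y * v $ y\<bar>)"
    by (simp add: matrix_vector_mult_def)
  also have "\<dots> \<le> (\<Sum>y\<in>UNIV. M $ x $ y * b)"
    using assms nonneg by (intro sum_mono) (simp add: abs_mult mult_left_mono)
  finally show ?thesis
    using row_sum by (simp flip: sum_distrib_right)
qed

text \<open>With \<open>h = D c\<close> and \<open>\<eta> = d \<bullet> c\<close>, the error \<open>T n - n \<eta> - h\<close> evolves by multiplication with \<open>M\<close>, so it stays
  bounded and vanishes after division by \<open>n\<close>.\<close>
lemma average_limit:
  assumes dM: "d v* M = d" and d1: "(\<Sum>x\<in>UNIV. d $ x) = 1"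
    and T0: "T 0 = 0" and T_Suc: "\<And>n. T (Suc n) = c + M *v T n"
  shows "(\<lambda>n. T n $ x / real n) \<longlonglongrightarrow> d \<bullet> c"
proof -
  define h where "h = group_inverse (mat 1 - M) *v c"
  have h: "h - M *v h = c - vec (d \<bullet> c)"
    using group_inverse_stationary(1)[OF dM d1, of c]
    by (simp add: h_def matrix_vector_mult_diff_rdistrib)
  define E where "E n = T n - real n *\<^sub>R vec (d \<bullet> c) - h" for n
  have E_Suc: "E (Suc n) = M *v E n" for n
    using h by (simp add: E_def T_Suc matrix_vector_mult_diff_distrib matrix_vector_mult_scaleR
        mult_const algebra_simps)
  define b where "b = (\<Sum>x\<in>UNIV. \<bar>h $ x\<bar>)"
  have hb: "\<bar>h $ x\<bar> \<le> b" for x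
    unfolding b_def by (rule member_le_sum) auto
  have Eb: "\<bar>E n $ x\<bar> \<le> b" for n x
  proof (induction n arbitrary: x)
    case 0
    show ?case using hb by (simp add: E_def T0)
  next
    case (Suc n)
    then show ?case unfolding E_Suc by (rule mult_bound)
  qed
  have "(\<lambda>n. (E n $ x + h $ x) / real n) \<longlonglongrightarrow> 0"
  proof (rule Lim_null_comparison)
    show "\<forall>\<^sub>F n in sequentially. norm ((E n $ x + h $ x) / real n) \<le> 2 * b / real n"
    proof (intro always_eventually allI)
      fix n
      have "\<bar>E n $ x + h $ x\<bar> \<le> 2 * b"
        using Eb[of n x] hb[of x] by linarith
      then show "norm ((E n $ x + h $ x) / real n) \<le> 2 * b / real n"
        by (simp add: divide_right_mono)
    qed
    show "(\<lambda>n. 2 * b / real n) \<longlonglongrightarrow> 0"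
      by (rule lim_const_over_n)
  qed
  then have "(\<lambda>n. d \<bullet> c + (E n $ x + h $ x) / real n) \<longlonglongrightarrow> d \<bullet> c + 0"
    by (intro tendsto_intros)
  \<comment> \<open>At \<open>n = 0\<close> the right-hand side is 0 by the convention for division
    by zero, so the equation is claimed only eventually.\<close>
  moreover have "\<forall>\<^sub>F n in sequentially. d \<bullet> c + (E n $ x + h $ x) / real n = T n $ x / real n"
    using eventually_gt_at_top[of 0] by eventually_elim (simp add: E_def field_simps)
  ultimately show ?thesis
    using Lim_transform_eventually by fastforce
qed

end

section \<open>The one-norm and the ergodicity coefficient\<close>

lemma norm1_nonneg: "0 \<le> norm1 x"
  by (simp add: norm1_def sum_nonneg)

lemma norm1_scaleR: "norm1 (c *\<^sub>R x) = \<bar>c\<bar> * norm1 x"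
  by (simp add: norm1_def abs_mult sum_distrib_left)

text \<open>Homogeneity extends the maximum over unit vectors of zero sum to all vectors of zero
  sum.\<close>

lemma norm1_ergodicity:
  fixes A :: "real ^ 'n ^ ('n::finite)"
  assumes sum0: "(\<Sum>i\<in>UNIV. u $ i) = 0"
  shows "norm1 (u v* A) \<le> ergodicity_coeff A * norm1 u"
proof (cases "u = 0")
  case True
  then show ?thesis by (simp add: norm1_def)
next
  case False
  then have "norm1 u \<noteq> 0"
    by (simp add: norm1_def sum_nonneg_eq_0_iff vec_eq_iff)
  then have pos: "0 < norm1 u"
    using norm1_nonneg[of u] by simp
  \<comment> \<open>In dimension one a vector of zero sum is zero, so the value 0 assigned to the
    coefficient there is consistent with the bound.\<close>
  have "CARD('n) \<noteq> 1"
  proof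
    assume "CARD('n) = 1"
    then obtain i :: 'n where "UNIV = {i}"
      by (auto simp: card_1_singleton_iff)
    then show False using sum0 pos by (metis norm1_def sum.empty sum.insert finite.emptyI empty_iff abs_zero add_0_right less_irrefl)
  qed
  then obtain x :: "real ^ 'n" where "ergodicity_coeff A = norm1 (transpose A *v x)"
    and max: "\<And>z. norm1 z = 1 \<Longrightarrow> (\<Sum>i\<in>UNIV. z $ i) = 0 \<Longrightarrow>
           norm1 (transpose A *v z) \<le> norm1 (transpose A *v x)"
    by (rule ergodicity_coeff_attained[of A]) (rule that)
  moreover have "norm1 (transpose A *v ((1 / norm1 u) *\<^sub>R u)) \<le> norm1 (transpose A *v x)"
    using pos sum0 by (intro max) (simp_all add: norm1_scaleR flip: sum_divide_distrib)
  ultimately show ?thesis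
    using pos by (simp add: scaleR_vector_matrix_assoc norm1_scaleR field_simps
        del: vector_scaleR_matrix_ac)
qed

section \<open>Policy matrices and their stationary distributions\<close>

lemma expectation_finite:
  fixes f :: "'b::finite \<Rightarrow> real"
  shows "measure_pmf.expectation p f = (\<Sum>a\<in>UNIV. pmf p a * f a)"
  by (subst integral_measure_pmf[of UNIV]) auto

lemma sum_pmf_finite: "(\<Sum>a\<in>UNIV. pmf p (a::'b::finite)) = 1"
  by (rule sum_pmf_eq_1) auto

lemma sum_pmf_mult_const: "(\<Sum>a\<in>UNIV. pmf p (a::'b::finite) * c) = c"
  by (simp add: sum_pmf_finite flip: sum_distrib_right)

lemma policy_matrix_row_sum: "(\<Sum>y\<in>UNIV. policy_matrix P \<pi> $ x $ y) = 1"
proof -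
  have "(\<Sum>y\<in>UNIV. policy_matrix P \<pi> $ x $ y) = (\<Sum>a\<in>UNIV. pmf (\<pi> x) a * (\<Sum>y\<in>UNIV. pmf (P x a) y))"
    unfolding policy_matrix_def sum_distrib_left by (simp, rule sum.swap)
  then show ?thesis by (simp add: sum_pmf_finite)
qed

lemma policy_matrix_mult:
  "(policy_matrix P \<pi> *v v) $ x
    = (\<Sum>a\<in>UNIV. pmf (\<pi> x) a * (\<Sum>y\<in>UNIV. pmf (P x a) y * v $ y))"
  unfolding policy_matrix_def matrix_vector_mult_def sum_distrib_left
  by (simp add: sum_distrib_right mult.assoc, rule sum.swap)

lemma policy_unichain_matrix:
  assumes "unichain P"
  shows "unichain_matrix (policy_matrix P \<pi>)"
proof
  show "0 \<le> policy_matrix P \<pi> $ x $ y" for x y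
    by (simp add: policy_matrix_def sum_nonneg)
  show "\<exists>!C. recurrent_class (policy_matrix P \<pi>) C"
    using assms unfolding unichain_def by blast
qed (rule policy_matrix_row_sum)

text \<open>A definite description satisfies its equation only once existence and uniqueness are
  known; they come from \<open>stationary_pmf_exists\<close> and
  \<open>group_inverse_stationary\<close>.\<close>

lemma stationary_dist:
  assumes "unichain P"
  shows "(\<chi> x. pmf (stationary_dist P \<pi>) x) v* policy_matrix P \<pi>
    = (\<chi> x. pmf (stationary_dist P \<pi>) x)"
proof -
  interpret unichain_matrix "policy_matrix P \<pi>"
    by (rule policy_unichain_matrix) fact
  obtain d where d: "(\<chi> x. pmf d x) v* policy_matrix P \<pi> = (\<chi> x. pmf d x)"
    by (rule stationary_pmf_exists)
  have "d' = d" if "(\<chi> x. pmf d' x) v* policy_matrix P \<pi> = (\<chi> x. pmf d' x)" for d'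
    using group_inverse_stationary(2)[OF d _ that]
    by (intro pmf_eqI) (simp add: sum_pmf_finite vec_eq_iff)
  with d have "stationary_dist P \<pi> = d"
    unfolding stationary_dist_def by (rule the_equality)
  with d show ?thesis by simp
qed

section \<open>Expected costs and the average-cost limit\<close>

definition policy_cost :: "('s::finite \<Rightarrow> 'a::finite \<Rightarrow> real) \<Rightarrow> ('s, 'a) policy \<Rightarrow> real ^ 's" where
  "policy_cost g \<pi> = (\<chi> x. \<Sum>a\<in>UNIV. pmf (\<pi> x) a * g x a)"

text \<open>Lists form an infinite type, so integrability of the total cost is drawn from the finite
  support.\<close>

lemma finite_set_trajectory:
  fixes P :: "('s::finite, 'a::finite) transition"
  shows "finite (set_pmf (trajectory P \<pi> N x))"
  by (induction N arbitrary: x) auto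

lemma expected_total_cost_initial:
  fixes P :: "('s::finite, 'a::finite) transition"
  shows "expected_total_cost P g \<pi> \<mu> N
    = (\<Sum>x\<in>UNIV. pmf \<mu> x * expected_total_cost P g \<pi> (return_pmf x) N)"
  unfolding expected_total_cost_def bind_return_pmf
  by (subst pmf_expectation_bind[of UNIV]) (auto simp: finite_set_trajectory)

lemma expected_total_cost_0: "expected_total_cost P g \<pi> \<mu> 0 = 0"
  by (simp add: expected_total_cost_def ext[of "trajectory P \<pi> 0" "\<lambda>_. return_pmf []"])

text \<open>Conditioning on the first action and the next state yields the recursion that
  \<open>average_limit\<close> asks of \<open>T\<close>.\<close>

lemma expected_total_cost_Suc:
  fixes P :: "('s::finite, 'a::finite) transition"
  shows "(\<chi> x. expected_total_cost P g \<pi> (return_pmf x) (Suc N))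
    = policy_cost g \<pi> + policy_matrix P \<pi> *v (\<chi> x. expected_total_cost P g \<pi> (return_pmf x) N)"
proof -
  let ?S = "\<lambda>\<omega>. \<Sum>(x, a)\<leftarrow>\<omega>. g x a"
  let ?E = "\<lambda>y. measure_pmf.expectation (trajectory P \<pi> N y) ?S"
  have cons: "measure_pmf.expectation (map_pmf ((#) (x, a)) (trajectory P \<pi> N y)) ?S = g x a + ?E y"
    for x y and a
    by (simp add: integrable_measure_pmf_finite finite_set_trajectory)
  have "measure_pmf.expectation (trajectory P \<pi> (Suc N) x) ?S
    = (\<Sum>a\<in>UNIV. pmf (\<pi> x) a * (\<Sum>y\<in>UNIV. pmf (P x a) y * (g x a + ?E y)))" for x
    unfolding trajectory.simps
    by (subst pmf_expectation_bind[of UNIV])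
      (auto simp: finite_set_trajectory cons pmf_expectation_bind[of UNIV] simp del: integral_map_pmf)
  also have "\<dots> x = (\<Sum>a\<in>UNIV. pmf (\<pi> x) a * (g x a + (\<Sum>y\<in>UNIV. pmf (P x a) y * ?E y)))" for x
    by (simp add: distrib_left sum.distrib sum_pmf_mult_const)
  finally show ?thesis
    by (simp add: vec_eq_iff policy_matrix_mult policy_cost_def expected_total_cost_def
        bind_return_pmf distrib_left sum.distrib)
qed

text \<open>The averages converge to the same value from every starting state, so averaging over the
  initial distribution preserves the limit.\<close>

lemma average_cost_eq:
  fixes P :: "('s::finite, 'a::finite) transition"
  assumes "unichain P"
  shows "average_cost P g \<mu> \<pi> = (\<chi> x. pmf (stationary_dist P \<pi>) x) \<bullet> policy_cost g \<pi>"
    (is "_ = ?\<eta>")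
proof -
  interpret unichain_matrix "policy_matrix P \<pi>"
    by (rule policy_unichain_matrix) fact
  let ?T = "\<lambda>n. \<chi> x. expected_total_cost P g \<pi> (return_pmf x) n"
  have "(\<lambda>n. ?T n $ x / real n) \<longlonglongrightarrow> ?\<eta>" for x
    by (rule average_limit[OF stationary_dist[OF assms]])
      (simp_all add: sum_pmf_finite expected_total_cost_Suc, simp add: vec_eq_iff expected_total_cost_0)
  then have "(\<lambda>n. \<Sum>x\<in>UNIV. pmf \<mu> x * (?T n $ x / real n)) \<longlonglongrightarrow> (\<Sum>x\<in>UNIV. pmf \<mu> x * ?\<eta>)"
    by (intro tendsto_intros)
  then have "(\<lambda>n. expected_total_cost P g \<pi> \<mu> n / real n) \<longlonglongrightarrow> ?\<eta>"
    by (simp add: expected_total_cost_initial[of _ _ _ \<mu>] sum_divide_distrib sum_pmf_finite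
        flip: sum_distrib_right)
  then show ?thesis
    unfolding average_cost_def by (rule limI)
qed

section \<open>Performance difference and perturbation of the stationary distribution\<close>

lemma expected_advantage:
  fixes P :: "('s::finite, 'a::finite) transition"
  shows "(\<chi> x. measure_pmf.expectation (\<pi>' x) (advantage P g \<mu> \<pi> x))
    = policy_cost g \<pi>' - vec (average_cost P g \<mu> \<pi>)
      + policy_matrix P \<pi>' *v (\<chi> x. relative_value P g \<mu> \<pi> x) - (\<chi> x. relative_value P g \<mu> \<pi> x)"
proof -
  have "measure_pmf.expectation (\<pi>' x) (advantage P g \<mu> \<pi> x)
    = policy_cost g \<pi>' $ x - average_cost P g \<mu> \<pi>
      + (policy_matrix P \<pi>' *v (\<chi> x. relative_value P g \<mu> \<pi> x)) $ x - relative_value P g \<mu> \<pi> x"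
    for x
    unfolding expectation_finite advantage_def Q_value_def policy_matrix_mult policy_cost_def
      right_diff_distrib distrib_left sum.distrib sum_subtractf sum_pmf_mult_const
    by simp
  then show ?thesis by (simp add: vec_eq_iff)
qed

text \<open>In the vector form of the expected advantage the relative values occur as a vector's
  image under the matrix of \<open>\<pi>'\<close> minus the vector itself, which the stationary
  distribution of \<open>\<pi>'\<close> annihilates.\<close>

lemma performance_difference:
  fixes P :: "('s::finite, 'a::finite) transition"
  assumes "unichain P"
  shows "average_cost P g \<mu> \<pi>' - average_cost P g \<mu> \<pi>
    = (\<chi> x. pmf (stationary_dist P \<pi>') x)
        \<bullet> (\<chi> x. measure_pmf.expectation (\<pi>' x) (advantage P g \<mu> \<pi> x))"
proof -
  let ?d = "\<chi> x. pmf (stationary_dist P \<pi>') x"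
  have "?d \<bullet> vec c = c" for c
    by (simp add: inner_vec_def sum_pmf_mult_const)
  then show ?thesis
    unfolding expected_advantage average_cost_eq[OF assms, of g \<mu> \<pi>']
    by (simp add: inner_add_right inner_diff_right stationary_dist[OF assms] flip: dot_lmul_matrix)
qed

text \<open>Pairing with an arbitrary \<open>v\<close> turns the row-vector identity into one about
  matrices acting on columns, where \<open>group_inverse_stationary\<close> applies.\<close>

lemma stationary_dist_diff:
  fixes P :: "('s::finite, 'a::finite) transition"
  assumes "unichain P"
  shows "(\<chi> x. pmf (stationary_dist P \<pi>2) x) - (\<chi> x. pmf (stationary_dist P \<pi>1) x)
    = ((\<chi> x. pmf (stationary_dist P \<pi>1) x) v* (policy_matrix P \<pi>2 - policy_matrix P \<pi>1))
        v* group_inverse (mat 1 - policy_matrix P \<pi>2)"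
    (is "?d2 - ?d1 = (?d1 v* (?P2 - ?P1)) v* ?D")
proof -
  interpret unichain_matrix ?P2
    by (rule policy_unichain_matrix) fact
  have "?d1 v* (?P2 - ?P1) = - (?d1 v* (mat 1 - ?P2))"
    by (simp add: vector_matrix_mult_diff_rdistrib stationary_dist[OF assms])
  then have "((?d1 v* (?P2 - ?P1)) v* ?D) \<bullet> v = - (?d1 \<bullet> ((mat 1 - ?P2) *v (?D *v v)))" for v
    by (simp add: dot_lmul_matrix)
  also have "\<dots> v = - (?d1 \<bullet> (v - vec (?d2 \<bullet> v)))" for v
    using group_inverse_stationary(1)[OF stationary_dist[OF assms]] by (simp add: sum_pmf_finite)
  also have "\<dots> v = (?d2 - ?d1) \<bullet> v" for v
  proof -
    have "?d1 \<bullet> vec c = c" for c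
      by (simp add: inner_vec_def sum_pmf_mult_const)
    then show ?thesis by (simp add: inner_diff_right inner_diff_left)
  qed
  finally show ?thesis
    by (metis vector_eq_rdot)
qed

section \<open>Total variation bound and final estimate\<close>

lemma norm1_policy_matrix_diff:
  fixes P :: "('s::finite, 'a::finite) transition"
  shows "norm1 ((\<chi> x. pmf d x) v* (policy_matrix P \<pi>2 - policy_matrix P \<pi>1))
    \<le> 2 * measure_pmf.expectation d (\<lambda>x. TV (\<pi>2 x) (\<pi>1 x))"
proof -
  let ?\<delta> = "\<lambda>x a. \<bar>pmf (\<pi>2 x) a - pmf (\<pi>1 x) a\<bar>"
  have entry: "\<bar>policy_matrix P \<pi>2 $ x $ y - policy_matrix P \<pi>1 $ x $ y\<bar>
    \<le> (\<Sum>a\<in>UNIV. ?\<delta> x a * pmf (P x a) y)" for x y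
  proof -
    have "policy_matrix P \<pi>2 $ x $ y - policy_matrix P \<pi>1 $ x $ y
      = (\<Sum>a\<in>UNIV. (pmf (\<pi>2 x) a - pmf (\<pi>1 x) a) * pmf (P x a) y)"
      by (simp add: policy_matrix_def left_diff_distrib sum_subtractf)
    also have "\<bar>\<dots>\<bar> \<le> (\<Sum>a\<in>UNIV. \<bar>(pmf (\<pi>2 x) a - pmf (\<pi>1 x) a) * pmf (P x a) y\<bar>)"
      by (rule sum_abs)
    finally show ?thesis by (simp add: abs_mult)
  qed
  have row: "(\<Sum>y\<in>UNIV. \<bar>policy_matrix P \<pi>2 $ x $ y - policy_matrix P \<pi>1 $ x $ y\<bar>)
    \<le> 2 * TV (\<pi>2 x) (\<pi>1 x)" for x
  proof -
    have "(\<Sum>y\<in>UNIV. \<bar>policy_matrix P \<pi>2 $ x $ y - policy_matrix P \<pi>1 $ x $ y\<bar>)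
      \<le> (\<Sum>y\<in>UNIV. \<Sum>a\<in>UNIV. ?\<delta> x a * pmf (P x a) y)"
      by (intro sum_mono entry)
    also have "\<dots> = (\<Sum>a\<in>UNIV. \<Sum>y\<in>UNIV. ?\<delta> x a * pmf (P x a) y)"
      by (rule sum.swap)
    \<comment> \<open>Each \<open>P x a\<close> has mass one, so summing over \<open>y\<close>
      leaves the action probabilities; the factor 2 undoes the half in \<open>TV\<close>.\<close>
    also have "\<dots> = 2 * TV (\<pi>2 x) (\<pi>1 x)"
      by (simp add: TV_def sum_pmf_finite flip: sum_distrib_left)
    finally show ?thesis .
  qed
  have "norm1 ((\<chi> x. pmf d x) v* (policy_matrix P \<pi>2 - policy_matrix P \<pi>1))
    \<le> (\<Sum>y\<in>UNIV. \<Sum>x\<in>UNIV. pmf d x * \<bar>policy_matrix P \<pi>2 $ x $ y - policy_matrix P \<pi>1 $ x $ y\<bar>)"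
    unfolding norm1_def vector_matrix_mult_def
    by (intro sum_mono, simp, rule order.trans[OF sum_abs]) (simp add: abs_mult mult.commute)
  also have "\<dots> = (\<Sum>x\<in>UNIV. pmf d x * (\<Sum>y\<in>UNIV. \<bar>policy_matrix P \<pi>2 $ x $ y - policy_matrix P \<pi>1 $ x $ y\<bar>))"
    unfolding sum_distrib_left by (rule sum.swap)
  also have "\<dots> \<le> (\<Sum>x\<in>UNIV. pmf d x * (2 * TV (\<pi>2 x) (\<pi>1 x)))"
    by (intro sum_mono mult_left_mono row) simp
  also have "\<dots> = 2 * measure_pmf.expectation d (\<lambda>x. TV (\<pi>2 x) (\<pi>1 x))"
    by (simp add: expectation_finite sum_distrib_left mult.left_commute)
  finally show ?thesis .
qed

lemma ergodicity_coeff_nonneg: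
  fixes A :: "real ^ 'n ^ ('n::finite)"
  shows "0 \<le> ergodicity_coeff A"
proof (cases "CARD('n) = 1")
  case True
  then show ?thesis by (simp add: ergodicity_coeff_def)
next
  case False
  then show ?thesis
    by (rule ergodicity_coeff_attained[of A]) (simp add: norm1_nonneg)
qed

theorem corollary1:
  fixes P :: "'s::finite \<Rightarrow> 'a::finite \<Rightarrow> 's pmf"
    and g :: "'s \<Rightarrow> 'a \<Rightarrow> real"
    and \<mu> :: "'s pmf"
    and \<pi>1 \<pi>2 :: "'s \<Rightarrow> 'a pmf"
  assumes "unichain P"
    and "\<And>x. convergent (relative_cost P g \<mu> \<pi>1 x)"
  shows "average_cost P g \<mu> \<pi>2 - average_cost P g \<mu> \<pi>1
    \<le> measure_pmf.expectation (stationary_dist P \<pi>1)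
          (\<lambda>x. measure_pmf.expectation (\<pi>2 x) (\<lambda>a. advantage P g \<mu> \<pi>1 x a))
      + 2 * max_expected_advantage P g \<mu> \<pi>1 \<pi>2
          * ergodicity_coeff (group_inverse (mat 1 - policy_matrix P \<pi>2))
          * measure_pmf.expectation (stationary_dist P \<pi>1) (\<lambda>x. TV (\<pi>2 x) (\<pi>1 x))"
proof -
  let ?d1 = "\<chi> x. pmf (stationary_dist P \<pi>1) x"
  let ?d2 = "\<chi> x. pmf (stationary_dist P \<pi>2) x"
  let ?f = "\<chi> x. measure_pmf.expectation (\<pi>2 x) (advantage P g \<mu> \<pi>1 x)"
  let ?\<epsilon> = "max_expected_advantage P g \<mu> \<pi>1 \<pi>2"
  let ?\<tau> = "ergodicity_coeff (group_inverse (mat 1 - policy_matrix P \<pi>2))"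
  let ?u = "?d1 v* (policy_matrix P \<pi>2 - policy_matrix P \<pi>1)"
  have \<epsilon>: "\<bar>?f $ x\<bar> \<le> ?\<epsilon>" for x
    unfolding max_expected_advantage_def vec_lambda_beta by (intro Max_ge) auto
  then have "0 \<le> ?\<epsilon>"
    using abs_ge_zero order.trans by blast
  interpret P1: unichain_matrix "policy_matrix P \<pi>1"
    by (rule policy_unichain_matrix) fact
  interpret P2: unichain_matrix "policy_matrix P \<pi>2"
    by (rule policy_unichain_matrix) fact
  \<comment> \<open>Both policy matrices preserve mass, which puts \<open>?u\<close> in the zero-sum
    space where the ergodicity coefficient applies.\<close>
  have "(\<Sum>i\<in>UNIV. ?u $ i) = 0"
    by (simp add: vector_matrix_mult_diff_rdistrib sum_subtractf P1.sum_vector_mult P2.sum_vector_mult)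
  then have "norm1 (?d2 - ?d1) \<le> ?\<tau> * norm1 ?u"
    unfolding stationary_dist_diff[OF assms(1)] by (rule norm1_ergodicity)
  also have "\<dots> \<le> ?\<tau> * (2 * measure_pmf.expectation (stationary_dist P \<pi>1) (\<lambda>x. TV (\<pi>2 x) (\<pi>1 x)))"
    by (intro mult_left_mono norm1_policy_matrix_diff ergodicity_coeff_nonneg)
  finally have dist: "norm1 (?d2 - ?d1) \<le> \<dots>" .
  \<comment> \<open>Hoelder's inequality, with \<open>?\<epsilon>\<close> as the maximum norm of
    \<open>?f\<close> against the one-norm of the difference.\<close>
  have "(?d2 - ?d1) \<bullet> ?f \<le> (\<Sum>x\<in>UNIV. \<bar>(?d2 - ?d1) $ x\<bar> * \<bar>?f $ x\<bar>)"
    unfolding inner_vec_def by (intro sum_mono) (simp add: flip: abs_mult)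
  also have "\<dots> \<le> (\<Sum>x\<in>UNIV. \<bar>(?d2 - ?d1) $ x\<bar> * ?\<epsilon>)"
    by (intro sum_mono mult_left_mono \<epsilon>) simp
  also have "\<dots> = ?\<epsilon> * norm1 (?d2 - ?d1)"
    unfolding norm1_def by (simp add: mult.commute flip: sum_distrib_left)
  also have "\<dots> \<le> ?\<epsilon> * (?\<tau> * (2 * measure_pmf.expectation (stationary_dist P \<pi>1) (\<lambda>x. TV (\<pi>2 x) (\<pi>1 x))))"
    using dist \<open>0 \<le> ?\<epsilon>\<close> by (rule mult_left_mono)
  finally have "?d2 \<bullet> ?f \<le> ?d1 \<bullet> ?f + \<dots>"
    by (simp add: inner_diff_left)
  moreover have "?d1 \<bullet> ?f = measure_pmf.expectation (stationary_dist P \<pi>1)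
      (\<lambda>x. measure_pmf.expectation (\<pi>2 x) (\<lambda>a. advantage P g \<mu> \<pi>1 x a))"
    by (simp add: inner_vec_def expectation_finite[of "stationary_dist P \<pi>1"])
  ultimately show ?thesis
    unfolding performance_difference[OF assms(1)] by (simp add: mult_ac)
qed

end
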